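(* Fix $x\in M$. Let $y_1,y_2\in T_xM\setminus\{0\}$ and let $\sigma_{\{y_1,y_2\}}\subset T_xM$ be the sector bounded by the rays of the vectors $y_1,y_2$ and the indicatrix arc between them (so $F(x,y)\le1$ on the sector), where $\theta$ is defined on the corresponding cone, is increasing along the arc from the direction of $y_1$ to that of $y_2$, and $\theta_a=\theta(x,y_a)$. Then the arc length $s$ of the indicatrix $\{F=1\}$ (measured in $T_xM$ by $ds=\sqrt{g_{ij}\,dl^i\,dl^j}$) satisfies $ds=d\theta$ along the arc, and the area $$\Sigma_{\{y_1,y_2\}}=\int_{\sigma_{\{y_1,y_2\}}}\sqrt{\det(g_{ij}(x,y))}\,dy^1dy^2$$ of the sector equals $$\Sigma_{\{y_1,y_2\}}=\tfrac12(\theta_2-\theta_1).$$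
   Context: $M$ is a 2-dimensional $C^\infty$ manifold with local coordinates $x^1,x^2$ and induced fibre coordinates $y^1,y^2$. $F=F(x,y)$ is a Finsler metric function (positive, positively homogeneous of degree 1 in $y$, sufficiently smooth for $y\ne0$, with positive definite metric tensor). Notation: $l^k=y^k/F$, $y_k=F\,\partial F/\partial y^k$, $g_{ij}=\partial y_i/\partial y^j$. With $\gamma_{11}=\gamma_{22}=0$, $\gamma_{12}=-\gamma_{21}=1$, put $\epsilon_{ik}=\sqrt{\det(g_{mn})}\,\gamma_{ik}$ and $m_i=-\epsilon_{ik}l^k$. The angle function $\theta=\theta(x,y)$ is a (smooth) function on a conic region, positively homogeneous of degree zero in $y$, satisfying $F\,\partial\theta/\partial y^n=m_n$. Repeated indices (running over $1,2$) are summed. *)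

theory Defs
  imports "HOL-Analysis.Analysis"
begin

text \<open>
  Everything is written in a chart of the two-dimensional manifold: \<open>U\<close> is an open subset of
  the plane (the coordinate domain), a point of the tangent bundle over the chart is a pair
  \<open>(x, y)\<close> with \<open>x \<in> U\<close> and \<open>y :: real^2\<close> (the fibre coordinates), and \<open>F x y\<close>
  is the metric function.
\<close>

text \<open>Functions of class \<open>C\<^sup>k\<close>; intended for open \<open>S\<close>.\<close>

primrec Ck_on :: "nat \<Rightarrow> 'a::euclidean_space set \<Rightarrow> ('a \<Rightarrow> real) \<Rightarrow> bool" where
  "Ck_on 0 S f \<longleftrightarrow> continuous_on S f"
| "Ck_on (Suc k) S f \<longleftrightarrow>
     (\<forall>p\<in>S. f differentiable (at p)) \<and>
     (\<forall>v. Ck_on k S (\<lambda>p. frechet_derivative f (at p) v))"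

definition partial :: "2 \<Rightarrow> (real^2 \<Rightarrow> real) \<Rightarrow> real^2 \<Rightarrow> real" where
  "partial k f y = deriv (\<lambda>t. f (y + t *\<^sub>R axis k 1)) 0"

definition unit_vec :: "(real^2 \<Rightarrow> real^2 \<Rightarrow> real) \<Rightarrow> real^2 \<Rightarrow> real^2 \<Rightarrow> real^2" where
  "unit_vec F x y = (\<chi> k. y $ k / F x y)"

definition covec :: "(real^2 \<Rightarrow> real^2 \<Rightarrow> real) \<Rightarrow> real^2 \<Rightarrow> real^2 \<Rightarrow> real^2" where
  "covec F x y = (\<chi> k. F x y * partial k (F x) y)"

definition metric_tensor :: "(real^2 \<Rightarrow> real^2 \<Rightarrow> real) \<Rightarrow> real^2 \<Rightarrow> real^2 \<Rightarrow> real^2^2" where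
  "metric_tensor F x y = (\<chi> i j. partial j (\<lambda>z. covec F x z $ i) y)"

text \<open>
  ``Sufficiently smooth'' is taken to be \<open>C\<^sup>2\<close> off the zero section, the least
  class for which the metric tensor is continuous.
\<close>

definition finsler_metric :: "(real^2) set \<Rightarrow> (real^2 \<Rightarrow> real^2 \<Rightarrow> real) \<Rightarrow> bool" where
  "finsler_metric U F \<longleftrightarrow>
     open U \<and>
     Ck_on 2 (U \<times> (- {0})) (\<lambda>(x, y). F x y) \<and>
     (\<forall>x\<in>U. \<forall>y. y \<noteq> 0 \<longrightarrow> F x y > 0) \<and>
     (\<forall>x\<in>U. \<forall>y. y \<noteq> 0 \<longrightarrow> (\<forall>t>0. F x (t *\<^sub>R y) = t * F x y)) \<and>
     (\<forall>x\<in>U. \<forall>y. y \<noteq> 0 \<longrightarrow> (\<forall>v. v \<noteq> 0 \<longrightarrow> v \<bullet> (metric_tensor F x y *v v) > 0))"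

definition gam :: "2 \<Rightarrow> 2 \<Rightarrow> real" where
  "gam i k = (if i = 1 \<and> k = 2 then 1 else if i = 2 \<and> k = 1 then - 1 else 0)"

definition eps :: "(real^2 \<Rightarrow> real^2 \<Rightarrow> real) \<Rightarrow> real^2 \<Rightarrow> real^2 \<Rightarrow> 2 \<Rightarrow> 2 \<Rightarrow> real" where
  "eps F x y i k = sqrt (det (metric_tensor F x y)) * gam i k"

definition m_covec :: "(real^2 \<Rightarrow> real^2 \<Rightarrow> real) \<Rightarrow> real^2 \<Rightarrow> real^2 \<Rightarrow> real^2" where
  "m_covec F x y = (\<chi> i. - (\<Sum>k\<in>UNIV. eps F x y i k * unit_vec F x y $ k))"

definition angle_function ::
  "(real^2) set \<Rightarrow> (real^2 \<Rightarrow> real^2 \<Rightarrow> real) \<Rightarrow> ((real^2) \<times> (real^2)) set \<Rightarrow>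
     (real^2 \<Rightarrow> real^2 \<Rightarrow> real) \<Rightarrow> bool" where
  "angle_function U F C \<theta> \<longleftrightarrow>
     open C \<and> C \<subseteq> U \<times> (- {0}) \<and>
     (\<forall>x y t. (x, y) \<in> C \<and> t > 0 \<longrightarrow> (x, t *\<^sub>R y) \<in> C) \<and>
     Ck_on 1 C (\<lambda>(x, y). \<theta> x y) \<and>
     (\<forall>x y t. (x, y) \<in> C \<and> t > 0 \<longrightarrow> \<theta> x (t *\<^sub>R y) = \<theta> x y) \<and>
     (\<forall>x y n. (x, y) \<in> C \<longrightarrow> F x y * partial n (\<theta> x) y = m_covec F x y $ n)"

text \<open>
  Two rays bound two sectors, so the arc is part of the data. Only weak monotonicity of \<open>\<theta>\<close>
  is imposed and \<open>c\<close> need not be injective; this covers the degenerate case of equal directions.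
\<close>

definition indicatrix_arc ::
  "(real^2 \<Rightarrow> real^2 \<Rightarrow> real) \<Rightarrow> ((real^2) \<times> (real^2)) set \<Rightarrow> (real^2 \<Rightarrow> real^2 \<Rightarrow> real) \<Rightarrow>
     real^2 \<Rightarrow> real^2 \<Rightarrow> real^2 \<Rightarrow> (real \<Rightarrow> real^2) \<Rightarrow> bool" where
  "indicatrix_arc F C \<theta> x y1 y2 c \<longleftrightarrow>
     c C1_differentiable_on {0..1} \<and>
     pathstart c = unit_vec F x y1 \<and> pathfinish c = unit_vec F x y2 \<and>
     (\<forall>u\<in>{0..1}. F x (c u) = 1 \<and> (x, c u) \<in> C) \<and>
     mono_on {0..1} (\<lambda>u. \<theta> x (c u))"

text \<open>On the indicatrix \<open>l = y\<close>, so \<open>ds\<close> is the speed below times \<open>du\<close>.\<close>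

definition finsler_speed ::
  "(real^2 \<Rightarrow> real^2 \<Rightarrow> real) \<Rightarrow> real^2 \<Rightarrow> (real \<Rightarrow> real^2) \<Rightarrow> real \<Rightarrow> real" where
  "finsler_speed F x c u =
     sqrt (\<Sum>i\<in>UNIV. \<Sum>j\<in>UNIV. metric_tensor F x (c u) $ i $ j *
        (vector_derivative c (at u) $ i) * (vector_derivative c (at u) $ j))"

definition sector :: "(real \<Rightarrow> real^2) \<Rightarrow> (real^2) set" where
  "sector c = {t *\<^sub>R p | t p. 0 \<le> t \<and> t \<le> 1 \<and> p \<in> path_image c}"

definition sector_area ::
  "(real^2 \<Rightarrow> real^2 \<Rightarrow> real) \<Rightarrow> real^2 \<Rightarrow> (real^2) set \<Rightarrow> real" where
  "sector_area F x S = integral S (\<lambda>y. sqrt (det (metric_tensor F x y)))"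

end

theory Submission
  imports Defs
begin

text \<open>
  Both assertions express one formula for the differential of the angle. On the indicatrix the
  equation \<open>F \<partial>\<theta>/\<partial>y\<^sup>n = m\<^sub>n\<close> says \<open>d\<theta> = \<surd>g (y\<^sup>1 dy\<^sup>2 - y\<^sup>2 dy\<^sup>1)\<close>, that is, \<open>d\<theta>\<close> is twice the Finslerian
  area of the infinitesimal triangle with vertices \<open>0\<close>, \<open>y\<close> and \<open>y + dy\<close>
  (\<open>angle_has_derivative\<close>).
  
  \<^emph>\<open>Arc length.\<close> By Euler's identity \<open>y\<close> is a \<open>g\<close>-unit vector orthogonal to the indicatrix, so for
  a tangent vector \<open>v\<close> the number \<open>g(v, v)\<close> equals the Gram determinant \<open>det g * (det(y, v))\<^sup>2\<close>
  (\<open>indicatrix_tangent_form\<close>). Hence \<open>ds = \<bar>d\<theta>\<bar>\<close>, and the sign is fixed by the monotonicity of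
  \<open>\<theta>\<close> along the arc (\<open>arc_angle_derivative\<close>).
  
  \<^emph>\<open>Area.\<close> The density \<open>\<surd>g\<close> is homogeneous of degree zero, hence constant on rays
  (\<open>metric_tensor_homogeneous\<close>). In the coordinates \<open>(t, u)\<close>, where \<open>y = t c(u)\<close>, the area element
  is \<open>t \<surd>g(c) \<bar>det(c, c')\<bar> dt du = t dt ds\<close>, and the integral over the sector is half of the arc length
  (\<open>sector_integral\<close>). The coordinates are injective up to a negligible set because \<open>\<theta>\<close> is
  single-valued: wherever the arc moves, it cannot come back to the same point
  (\<open>arc_injective_where_moving\<close>).
\<close>

section \<open>Partial derivatives on a single tangent space\<close>

lemma partial_eq_derivative:
  assumes "(f has_derivative f') (at y)"
  shows "partial k f y = f' (axis k 1)"
proof -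
  have "((\<lambda>t. y + t *\<^sub>R axis k 1) has_derivative (\<lambda>t. t *\<^sub>R axis k 1)) (at 0)"
    by (auto intro!: derivative_eq_intros)
  moreover have "(f has_derivative f') (at (y + 0 *\<^sub>R axis k 1))"
    using assms by simp
  ultimately have "((\<lambda>t. f (y + t *\<^sub>R axis k 1)) has_derivative (\<lambda>t. f' (t *\<^sub>R axis k 1))) (at 0)"
    by (rule has_derivative_compose)
  moreover have "f' (t *\<^sub>R axis k 1) = f' (axis k 1) * t" for t
    using has_derivative_linear[OF assms] by (simp add: linear_cmul)
  ultimately show ?thesis
    unfolding partial_def by (auto intro!: DERIV_imp_deriv simp: has_field_derivative_def)
qed

lemma has_derivative_partial:
  assumes "f differentiable (at y)"
  shows "(f has_derivative (\<lambda>v. \<Sum>k\<in>UNIV. partial k f y * v $ k)) (at y)"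
proof -
  obtain f' where f': "(f has_derivative f') (at y)"
    using assms by (auto simp: differentiable_def)
  have "f' v = (\<Sum>k\<in>UNIV. partial k f y * v $ k)" for v
  proof -
    have "f' v = f' (\<Sum>k\<in>UNIV. v $ k *\<^sub>R axis k 1)"
      by (simp add: basis_expansion scalar_mult_eq_scaleR[symmetric])
    also have "\<dots> = (\<Sum>k\<in>UNIV. partial k f y * v $ k)"
      using has_derivative_linear[OF f']
      by (simp add: linear_sum linear_cmul partial_eq_derivative[OF f'] mult.commute)
    finally show ?thesis .
  qed
  then have "f' = (\<lambda>v. \<Sum>k\<in>UNIV. partial k f y * v $ k)"
    by (rule ext)
  with f' show ?thesis by simp
qed

lemma partial_cong:
  assumes "open S" "y \<in> S" "\<And>z. z \<in> S \<Longrightarrow> f z = g z" "g differentiable (at y)"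
  shows "partial k f y = partial k g y"
proof -
  have g: "(g has_derivative (\<lambda>v. \<Sum>k\<in>UNIV. partial k g y * v $ k)) (at y)"
    by (rule has_derivative_partial) fact
  then have "(f has_derivative (\<lambda>v. \<Sum>k\<in>UNIV. partial k g y * v $ k)) (at y)"
    by (rule has_derivative_transform_within_open[OF _ assms(1,2)]) (simp add: assms(3))
  then show ?thesis
    using partial_eq_derivative[OF g] partial_eq_derivative by metis
qed

text \<open>
  Smoothness of \<open>F\<close> and \<open>\<theta>\<close> is given jointly in \<open>(x, y)\<close>, by Frechet derivatives on the product
  space, whereas everything that follows happens in one tangent space. The next three lemmas pass
  to the slice \<open>x = const\<close>: a partial derivative in \<open>y\<close> is the joint derivative in the
  direction \<open>(0, e\<^sub>k)\<close>, so it inherits the smoothness of the latter.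
\<close>

lemma slice_has_derivative:
  fixes h :: "real^2 \<Rightarrow> real^2 \<Rightarrow> real"
  assumes "(\<lambda>(x, y). h x y) differentiable (at (x, y))"
  shows "(h x has_derivative (\<lambda>v. frechet_derivative (\<lambda>(x, y). h x y) (at (x, y)) (0, v))) (at y)"
proof -
  have "((\<lambda>z. (x, z)) has_derivative (\<lambda>v. (0, v))) (at y)"
    by (auto intro!: derivative_eq_intros)
  from has_derivative_compose[OF this assms[unfolded frechet_derivative_works]]
  show ?thesis by simp
qed

lemma C1_slice:
  fixes h :: "real^2 \<Rightarrow> real^2 \<Rightarrow> real"
  assumes "Ck_on (Suc 0) S (\<lambda>(x, y). h x y)" "\<And>y. y \<in> T \<Longrightarrow> (x, y) \<in> S"
  shows "\<And>y. y \<in> T \<Longrightarrow> h x differentiable (at y)" and "continuous_on T (partial k (h x))"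
proof -
  have diff: "(\<lambda>(x, y). h x y) differentiable (at (x, y))" if "y \<in> T" for y
    using assms that by auto
  show "h x differentiable (at y)" if "y \<in> T" for y
    using slice_has_derivative[OF diff[OF that]] by (auto simp: differentiable_def)
  have "continuous_on S (\<lambda>p. frechet_derivative (\<lambda>(x, y). h x y) (at p) (0, axis k 1))"
    using assms by simp
  then have "continuous_on T ((\<lambda>p. frechet_derivative (\<lambda>(x, y). h x y) (at p) (0, axis k 1)) \<circ> Pair x)"
    by (intro continuous_on_compose) (auto intro!: continuous_intros elim: continuous_on_subset simp: assms(2))
  then show "continuous_on T (partial k (h x))"
    by (rule continuous_on_eq) (simp add: partial_eq_derivative[OF slice_has_derivative[OF diff]])
qed

lemma C2_slice:
  fixes h :: "real^2 \<Rightarrow> real^2 \<Rightarrow> real"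
  assumes C2: "Ck_on (Suc (Suc 0)) S (\<lambda>(x, y). h x y)" and T: "open T" "\<And>y. y \<in> T \<Longrightarrow> (x, y) \<in> S"
  shows "\<And>y. y \<in> T \<Longrightarrow> h x differentiable (at y)"
    and "\<And>y. y \<in> T \<Longrightarrow> partial i (h x) differentiable (at y)"
    and "continuous_on T (partial j (partial i (h x)))"
proof -
  have diff: "(\<lambda>(x, y). h x y) differentiable (at (x, y))" if "y \<in> T" for y
    using C2 T that by auto
  show "h x differentiable (at y)" if "y \<in> T" for y
    using slice_has_derivative[OF diff[OF that]] by (auto simp: differentiable_def)
  define G where "G x y = frechet_derivative (\<lambda>(x, y). h x y) (at (x, y)) (0, axis i 1)" for x y
  have "Ck_on (Suc 0) S (\<lambda>p. frechet_derivative (\<lambda>(x, y). h x y) (at p) (0, axis i 1))"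
    using C2 unfolding Ck_on.simps(2)[of "Suc 0"] by blast
  moreover have "(\<lambda>p. frechet_derivative (\<lambda>(x, y). h x y) (at p) (0, axis i 1)) = (\<lambda>(x, y). G x y)"
    by (auto simp: G_def)
  ultimately have "Ck_on (Suc 0) S (\<lambda>(x, y). G x y)"
    by metis
  from C1_slice[OF this, of T x] T(2)
  have G: "\<And>y. y \<in> T \<Longrightarrow> G x differentiable (at y)" "continuous_on T (partial j (G x))"
    by blast+
  have eq: "partial i (h x) y = G x y" if "y \<in> T" for y
    using partial_eq_derivative[OF slice_has_derivative[OF diff[OF that]]] by (simp add: G_def)
  show "partial i (h x) differentiable (at y)" if "y \<in> T" for y
    using has_derivative_transform_within_open[OF _ T(1) that] G(1)[OF that] eq
    unfolding differentiable_def by metis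
  show "continuous_on T (partial j (partial i (h x)))"
    by (rule continuous_on_eq[OF G(2)]) (auto intro!: partial_cong[OF T(1), symmetric] G(1) eq)
qed

section \<open>The metric tensor and the angle\<close>

text \<open>
  Differentiate \<open>f (t z) = t f z\<close> in \<open>z\<close>: the factor \<open>t\<close> cancels, so the first derivatives of a
  function homogeneous of degree one are homogeneous of degree zero.
\<close>

lemma partial_homogeneous:
  assumes hom: "\<And>z. z \<noteq> 0 \<Longrightarrow> f (t *\<^sub>R z) = t * f z" and "t > 0" "y \<noteq> 0"
    and diff: "f differentiable (at y)" "f differentiable (at (t *\<^sub>R y))"
  shows "partial k f (t *\<^sub>R y) = partial k f y"
proof -
  let ?D = "\<lambda>y v. \<Sum>k\<in>UNIV. partial k f y * v $ k"
  have "((\<lambda>z. t *\<^sub>R z) has_derivative (\<lambda>v. t *\<^sub>R v)) (at y)"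
    by (auto intro!: derivative_eq_intros)
  from has_derivative_compose[OF this has_derivative_partial[OF diff(2)]]
  have "((\<lambda>z. f (t *\<^sub>R z)) has_derivative (\<lambda>v. ?D (t *\<^sub>R y) (t *\<^sub>R v))) (at y)" .
  moreover have "((\<lambda>z. t * f z) has_derivative (\<lambda>v. t * ?D y v)) (at y)"
    by (intro has_derivative_mult_right has_derivative_partial diff)
  then have "((\<lambda>z. f (t *\<^sub>R z)) has_derivative (\<lambda>v. t * ?D y v)) (at y)"
    by (rule has_derivative_transform_within_open[where s = "- {0}"]) (use hom \<open>y \<noteq> 0\<close> in auto)
  ultimately have "(\<lambda>v. ?D (t *\<^sub>R y) (t *\<^sub>R v)) = (\<lambda>v. t * ?D y v)"
    by (rule has_derivative_unique)
  then have "?D (t *\<^sub>R y) (t *\<^sub>R axis k 1) = t * ?D y (axis k 1)"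
    by (rule fun_cong)
  then show ?thesis
    using \<open>t > 0\<close> by (simp add: axis_def if_distrib[of "\<lambda>x. _ * x"] cong: if_cong)
qed

text \<open>
  Differentiate \<open>f (t y) = t f y\<close> in \<open>t\<close> at \<open>t = 1\<close>.
\<close>

lemma Euler_identity:
  assumes "\<And>t. t > 0 \<Longrightarrow> f (t *\<^sub>R y) = t * f y" "f differentiable (at y)"
  shows "(\<Sum>k\<in>UNIV. partial k f y * y $ k) = f y"
proof -
  have 1: "((\<lambda>t. t *\<^sub>R y) has_derivative (\<lambda>t. t *\<^sub>R y)) (at 1)"
    by (auto intro!: derivative_eq_intros)
  have "(f has_derivative (\<lambda>v. \<Sum>k\<in>UNIV. partial k f y * v $ k)) (at (1 *\<^sub>R y))"
    using has_derivative_partial[OF assms(2)] by simp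
  from has_derivative_compose[OF 1 this]
  have "((\<lambda>t. f (t *\<^sub>R y)) has_derivative (\<lambda>t. \<Sum>k\<in>UNIV. partial k f y * (t *\<^sub>R y) $ k)) (at 1)" .
  moreover have "((\<lambda>t. t * f y) has_derivative (\<lambda>t. t * f y)) (at 1)"
    by (auto intro!: derivative_eq_intros)
  then have "((\<lambda>t. f (t *\<^sub>R y)) has_derivative (\<lambda>t. t * f y)) (at 1)"
    by (rule has_derivative_transform_within_open[where s = "{0<..}"]) (use assms in auto)
  ultimately have "(\<lambda>t. \<Sum>k\<in>UNIV. partial k f y * (t *\<^sub>R y) $ k) = (\<lambda>t. t * f y)"
    by (rule has_derivative_unique)
  from fun_cong[OF this, of 1] show ?thesis by simp
qed

lemma
  assumes F: "finsler_metric U F" and x: "x \<in> U"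
  shows finsler_differentiable: "y \<noteq> 0 \<Longrightarrow> F x differentiable (at y)"
    and covec_differentiable: "y \<noteq> 0 \<Longrightarrow> (\<lambda>z. covec F x z $ i) differentiable (at y)"
    and continuous_metric_tensor: "continuous_on (- {0}) (\<lambda>y. metric_tensor F x y $ i $ j)"
proof -
  have "Ck_on (Suc (Suc 0)) (U \<times> (- {0})) (\<lambda>(x, y). F x y)"
    using F unfolding finsler_metric_def numeral_2_eq_2 by blast
  note slice = C2_slice[OF this, of "- {0}" x]
  have diff: "F x differentiable (at y)" if "y \<noteq> 0" for y
    using slice(1) that x by auto
  have diff2: "partial i (F x) differentiable (at y)" if "y \<noteq> 0" for i y
    using slice(2) that x by auto
  have cont2: "continuous_on (- {0}) (partial j (partial i (F x)))" for i j
    using slice(3) x by auto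
  have cov: "((\<lambda>z. covec F x z $ i) has_derivative
      (\<lambda>v. F x y * (\<Sum>k\<in>UNIV. partial k (partial i (F x)) y * v $ k)
        + (\<Sum>k\<in>UNIV. partial k (F x) y * v $ k) * partial i (F x) y)) (at y)" if "y \<noteq> 0" for i y
    unfolding covec_def vec_lambda_beta
    by (intro has_derivative_mult has_derivative_partial diff diff2 that)
  show "F x differentiable (at y)" if "y \<noteq> 0"
    by (rule diff) fact
  show "(\<lambda>z. covec F x z $ i) differentiable (at y)" if "y \<noteq> 0"
    using cov[OF that] by (auto simp: differentiable_def)
  have cont: "continuous_on (- {0}) (F x)" "continuous_on (- {0}) (partial i (F x))" for i
    using diff diff2
    by (auto intro!: differentiable_imp_continuous_on differentiable_at_imp_differentiable_on)
  have "metric_tensor F x y $ i $ j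
      = F x y * partial j (partial i (F x)) y + partial j (F x) y * partial i (F x) y" if "y \<noteq> 0" for y
    unfolding metric_tensor_def vec_lambda_beta partial_eq_derivative[OF cov[OF that]]
    by (simp add: axis_def if_distrib[of "\<lambda>x. _ * x"] cong: if_cong)
  then show "continuous_on (- {0}) (\<lambda>y. metric_tensor F x y $ i $ j)"
    by (subst continuous_on_cong[OF refl]) (auto intro!: continuous_intros cont cont2)
qed

lemma covec_homogeneous:
  assumes F: "finsler_metric U F" and x: "x \<in> U" and "y \<noteq> 0" "t > 0"
  shows "covec F x (t *\<^sub>R y) = t *\<^sub>R covec F x y"
proof -
  have hom: "F x (t *\<^sub>R z) = t * F x z" if "z \<noteq> 0" for z
    using F x that \<open>t > 0\<close> unfolding finsler_metric_def by blast
  have "partial k (F x) (t *\<^sub>R y) = partial k (F x) y" for k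
    using assms by (intro partial_homogeneous hom finsler_differentiable[OF F x]) auto
  then show ?thesis
    using hom[OF \<open>y \<noteq> 0\<close>] by (simp add: covec_def vec_eq_iff)
qed

text \<open>
  Euler's identity for \<open>F\<close> gives \<open>y\<^sub>k y\<^sup>k = F\<^sup>2\<close>; below, Euler's identity for the components \<open>y\<^sub>i\<close>,
  which are again homogeneous of degree one, gives \<open>g\<^sub>i\<^sub>j y\<^sup>j = y\<^sub>i\<close>.
\<close>

lemma covec_self:
  assumes F: "finsler_metric U F" and x: "x \<in> U" and "y \<noteq> 0"
  shows "(\<Sum>k\<in>UNIV. covec F x y $ k * y $ k) = (F x y)\<^sup>2"
proof -
  have "(\<Sum>k\<in>UNIV. partial k (F x) y * y $ k) = F x y"
    using F x \<open>y \<noteq> 0\<close> unfolding finsler_metric_def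
    by (intro Euler_identity finsler_differentiable[OF F x]) auto
  then show ?thesis
    by (simp add: covec_def power2_eq_square sum_distrib_left[symmetric] mult.assoc)
qed

lemma metric_tensor_self:
  assumes F: "finsler_metric U F" and x: "x \<in> U" and "y \<noteq> 0"
  shows "(\<Sum>j\<in>UNIV. metric_tensor F x y $ i $ j * y $ j) = covec F x y $ i"
  unfolding metric_tensor_def vec_lambda_beta
  using covec_homogeneous[OF F x \<open>y \<noteq> 0\<close>]
  by (intro Euler_identity covec_differentiable[OF F x \<open>y \<noteq> 0\<close>]) simp

lemma metric_tensor_homogeneous:
  assumes F: "finsler_metric U F" and x: "x \<in> U" and "y \<noteq> 0" "t > 0"
  shows "metric_tensor F x (t *\<^sub>R y) = metric_tensor F x y"
  unfolding metric_tensor_def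
  using assms covec_homogeneous[OF F x]
  by (intro Cart_lambda_cong partial_homogeneous covec_differentiable[OF F x]) auto

text \<open>
  For a matrix that is not known to be symmetric. Evaluating the form at
  \<open>(- (b + c), 2 a)\<close>, the minimiser along the line with second coordinate \<open>2 a\<close>, gives
  \<open>4 a d > (b + c)\<^sup>2\<close>, and \<open>(b + c)\<^sup>2 \<ge> 4 b c\<close>.
\<close>

lemma det_pos_of_positive_form:
  fixes A :: "real^2^2"
  assumes pos: "\<And>v. v \<noteq> 0 \<Longrightarrow> v \<bullet> (A *v v) > 0"
  shows "det A > 0"
proof -
  let ?a = "A$1$1" and ?b = "A$1$2" and ?c = "A$2$1" and ?d = "A$2$2"
  have form: "v \<bullet> (A *v v) = ?a * (v$1)\<^sup>2 + (?b + ?c) * v$1 * v$2 + ?d * (v$2)\<^sup>2" for v :: "real^2"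
    by (simp add: inner_vec_def matrix_vector_mult_def sum_2 power2_eq_square algebra_simps)
  have a: "?a > 0"
    using pos[of "vector [1, 0]"] unfolding form by (simp add: vec_eq_iff forall_2)
  have "?a * (4 * ?a * ?d - (?b + ?c)\<^sup>2) > 0"
    using pos[of "vector [- (?b + ?c), 2 * ?a]"] a unfolding form
    by (simp add: vec_eq_iff forall_2 power2_eq_square algebra_simps)
  then have "4 * ?a * ?d > (?b + ?c)\<^sup>2"
    using a by (simp add: zero_less_mult_iff)
  moreover have "(?b - ?c)\<^sup>2 \<ge> 0" by simp
  ultimately show ?thesis
    by (simp add: det_2 power2_eq_square algebra_simps)
qed

lemma det_metric_tensor_pos:
  assumes F: "finsler_metric U F" and x: "x \<in> U" and "y \<noteq> 0"
  shows "det (metric_tensor F x y) > 0"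
  using assms unfolding finsler_metric_def by (intro det_pos_of_positive_form) blast

text \<open>
  On the indicatrix the vector \<open>y\<close> has \<open>g\<close>-length one and is \<open>g\<close>-orthogonal to each tangent
  vector \<open>v\<close>, so \<open>g(v, v)\<close> is the Gram determinant of \<open>y\<close> and \<open>v\<close>. That determinant is
  \<open>det g\<close> times the square of the coordinate determinant of \<open>y\<close> and \<open>v\<close>.
\<close>

lemma indicatrix_tangent_form:
  assumes F: "finsler_metric U F" and x: "x \<in> U" and "F x y = 1" "y \<noteq> 0"
    and tangent: "(\<Sum>k\<in>UNIV. covec F x y $ k * v $ k) = 0"
  shows "(\<Sum>i\<in>UNIV. \<Sum>j\<in>UNIV. metric_tensor F x y $ i $ j * v $ i * v $ j)
    = det (metric_tensor F x y) * (y$1 * v$2 - y$2 * v$1)\<^sup>2"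
proof -
  let ?g = "\<lambda>i j. metric_tensor F x y $ i $ j"
  have r1: "?g 1 1 * y$1 + ?g 1 2 * y$2 = covec F x y $ 1"
    and r2: "?g 2 1 * y$1 + ?g 2 2 * y$2 = covec F x y $ 2"
    using metric_tensor_self[OF F x \<open>y \<noteq> 0\<close>] by (auto simp: sum_2)
  have gyy: "(?g 1 1 * y$1 + ?g 1 2 * y$2) * y$1 + (?g 2 1 * y$1 + ?g 2 2 * y$2) * y$2 = 1"
    using covec_self[OF F x \<open>y \<noteq> 0\<close>] \<open>F x y = 1\<close> by (simp add: r1 r2 sum_2)
  have gvy: "(?g 1 1 * y$1 + ?g 1 2 * y$2) * v$1 + (?g 2 1 * y$1 + ?g 2 2 * y$2) * v$2 = 0"
    using tangent by (simp add: r1 r2 sum_2)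
  define gvv where "gvv = ?g 1 1 * v$1 * v$1 + ?g 1 2 * v$1 * v$2 + (?g 2 1 * v$2 * v$1 + ?g 2 2 * v$2 * v$2)"
  define gyv where "gyv = (?g 1 1 * v$1 + ?g 1 2 * v$2) * y$1 + (?g 2 1 * v$1 + ?g 2 2 * v$2) * y$2"
  \<comment> \<open>The Gram identity \<open>det g * det(y, v)\<^sup>2 = g(y, y) g(v, v) - g(v, y) g(y, v)\<close> for a general
    bilinear form; here \<open>g(y, y) = 1\<close> and \<open>g(v, y) = 0\<close>.\<close>
  have "(?g 1 1 * ?g 2 2 - ?g 1 2 * ?g 2 1) * (y$1 * v$2 - y$2 * v$1)\<^sup>2
      = ((?g 1 1 * y$1 + ?g 1 2 * y$2) * y$1 + (?g 2 1 * y$1 + ?g 2 2 * y$2) * y$2) * gvv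
      - gyv * ((?g 1 1 * y$1 + ?g 1 2 * y$2) * v$1 + (?g 2 1 * y$1 + ?g 2 2 * y$2) * v$2)"
    unfolding gvv_def gyv_def by algebra
  also have "\<dots> = gvv"
    unfolding gyy gvy by simp
  finally show ?thesis
    by (simp add: det_2 sum_2 gvv_def)
qed

text \<open>
  The defining equation \<open>F \<partial>\<theta>/\<partial>y\<^sup>n = m\<^sub>n\<close>, written out where \<open>F = 1\<close>: the differential of \<open>\<theta>\<close> is
  the oriented area form \<open>\<surd>g det(y, dy)\<close>.
\<close>

lemma angle_has_derivative:
  assumes \<theta>: "angle_function U F C \<theta>" and C: "(x, y) \<in> C" and "F x y = 1"
  shows "(\<theta> x has_derivative (\<lambda>v. sqrt (det (metric_tensor F x y)) * (y$1 * v$2 - y$2 * v$1))) (at y)"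
proof -
  have "Ck_on (Suc 0) C (\<lambda>(x, y). \<theta> x y)"
    using \<theta> by (simp add: angle_function_def)
  from C1_slice(1)[OF this, of "{y}" x] C have "\<theta> x differentiable (at y)"
    by auto
  then have "(\<theta> x has_derivative (\<lambda>v. \<Sum>k\<in>UNIV. partial k (\<theta> x) y * v $ k)) (at y)"
    by (rule has_derivative_partial)
  moreover have "partial k (\<theta> x) y = m_covec F x y $ k" for k
  proof -
    have "F x y * partial k (\<theta> x) y = m_covec F x y $ k"
      using \<theta> C unfolding angle_function_def by blast
    then show ?thesis
      using \<open>F x y = 1\<close> by simp
  qed
  ultimately show ?thesis
    using \<open>F x y = 1\<close>
    by (simp add: sum_2 m_covec_def eps_def gam_def unit_vec_def algebra_simps)
qed

section \<open>The area of a sector swept by a curve\<close>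

text \<open>
  Fubini's theorem for continuous functions is stated for pairs of reals, and the change of
  variables formula for \<open>real^2\<close>; the identification of the two preserves boxes and their content.
\<close>

lemma integral_unit_square_product:
  fixes f g :: "real \<Rightarrow> real"
  assumes f: "continuous_on {0..1} f" and g: "continuous_on {0..1} g"
  shows "((\<lambda>z::real^2. f (z$1) * g (z$2)) has_integral (integral {0..1} f * integral {0..1} g)) (cbox 0 1)"
proof -
  let ?p = "\<lambda>z::real^2. (z$1, z$2)" and ?v = "\<lambda>(a, b). vector [a, b] :: real^2"
  have img: "?p ` cbox u v = cbox (?p u) (?p v)" for u v
  proof -
    have "(a, b) \<in> ?p ` cbox u v" if "(a, b) \<in> cbox (?p u) (?p v)" for a b
      using that by (intro image_eqI[of _ _ "vector [a, b]"])
        (auto simp: mem_box_cart forall_2 cbox_Pair_eq)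
    then show ?thesis
      by (auto simp: mem_box_cart cbox_Pair_eq)
  qed
  have vp: "?v (?p z) = z" for z
    by (simp add: vec_eq_iff forall_2)
  have pv: "?p (?v q) = q" for q
    by (cases q) simp
  have img': "?v ` cbox a b = cbox (?v a) (?v b)" for a b
  proof -
    have "cbox (?v a) (?v b) = ?v ` ?p ` cbox (?v a) (?v b)"
      by (simp only: image_image vp) simp
    also have "\<dots> = ?v ` cbox a b"
      by (simp only: img pv)
    finally show ?thesis by (rule sym)
  qed
  let ?F = "\<lambda>(a, b). f a * g b"
  have cont: "continuous_on (cbox (0, 0) (1, 1)) ?F"
    unfolding case_prod_beta
    by (intro continuous_intros continuous_on_compose2[OF f] continuous_on_compose2[OF g])
      (auto simp: cbox_Pair_eq)
  have "integral (cbox (0, 0) (1, 1)) ?F = integral {0..1} f * integral {0..1} g"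
    using integral_prod_continuous[OF cont] by simp
  then have F: "(?F has_integral (integral {0..1} f * integral {0..1} g)) (cbox (0, 0) (1, 1))"
    using integrable_continuous[OF cont] by (metis integrable_integral)
  have "((\<lambda>z. ?F (?p z)) has_integral (1 / 1) *\<^sub>R (integral {0..1} f * integral {0..1} g))
      (?v ` cbox (0, 0) (1, 1))"
  proof -
    have 1: "isCont ?p z" for z
      by (intro continuous_intros)
    have 2: "measure lborel (?p ` cbox u v) = 1 * measure lborel (cbox u v)" for u v
    proof (cases "cbox u v = {}")
      case False
      then have "u$1 \<le> v$1" "u$2 \<le> v$2"
        by (auto simp: interval_ne_empty_cart)
      then show ?thesis
        unfolding img content_Pair by (simp add: content_cbox_cart[OF False] UNIV_2)
    qed simp
    show ?thesis
      by (rule has_integral_twiddle[OF zero_less_one vp pv 1 _ _ 2 F])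
        (use img img' in blast)+
  qed
  moreover have "?v ` cbox (0, 0) (1, 1) = cbox 0 1"
    unfolding img' by (auto simp: mem_box_cart forall_2)
  ultimately show ?thesis by simp
qed

text \<open>
  The area formula \<open>\<integral> w = (1/2) \<integral> w(c) \<bar>det(c, c')\<bar> du\<close> for a sector swept by a curve and a density
  that is constant on rays. The sector is the image of the unit square under \<open>(t, u) \<mapsto> t c(u)\<close>,
  whose Jacobian is \<open>t det(c, c')\<close>, and \<open>\<integral> t dt = 1/2\<close>. The curve may rest or move radially on
  some parameter intervals, so injectivity is required only where the Jacobian does not vanish;
  the rest of the square, the edge \<open>t = 0\<close> included, has a negligible image by Sard's lemma.
\<close>

lemma sector_integral:
  fixes c D :: "real \<Rightarrow> real^2" and w :: "real^2 \<Rightarrow> real"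
  defines "J \<equiv> \<lambda>u. c u $ 1 * D u $ 2 - c u $ 2 * D u $ 1"
  assumes c: "\<And>u. u \<in> {0..1} \<Longrightarrow> (c has_vector_derivative D u) (at u)"
    and D: "continuous_on {0..1} D"
    and w: "continuous_on {0..1} (\<lambda>u. w (c u))"
    and radial: "\<And>t u. \<lbrakk>0 < t; t \<le> 1; u \<in> {0..1}\<rbrakk> \<Longrightarrow> w (t *\<^sub>R c u) = w (c u)"
    and inj: "inj_on (\<lambda>(t, u). t *\<^sub>R c u) ({0<..1} \<times> {u \<in> {0..1}. J u \<noteq> 0})"
  shows "w absolutely_integrable_on sector c"
    and "integral (sector c) w = integral {0..1} (\<lambda>u. w (c u) * \<bar>J u\<bar>) / 2"
proof -
  let ?\<Phi> = "\<lambda>z::real^2. z$1 *\<^sub>R c (z$2)"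
  let ?\<Phi>' = "\<lambda>z v::real^2. z$1 *\<^sub>R (v$2 *\<^sub>R D (z$2)) + v$1 *\<^sub>R c (z$2)"
  let ?B = "cbox 0 1 :: (real^2) set"
  let ?S = "{z \<in> ?B. z$1 * J (z$2) \<noteq> 0}" and ?N = "{z \<in> ?B. z$1 * J (z$2) = 0}"
  have B: "z \<in> ?B \<longleftrightarrow> z$1 \<in> {0..1} \<and> z$2 \<in> {0..1}" for z
    by (auto simp: mem_box_cart forall_2)
  have der: "(?\<Phi> has_derivative ?\<Phi>' z) (at z within T)" if "z \<in> ?B" for z T
  proof -
    have 1: "((\<lambda>z::real^2. z$i) has_derivative (\<lambda>v. v$i)) (at z within T)" for i
      by (rule bounded_linear_imp_has_derivative[OF bounded_linear_vec_nth])
    have "(c has_derivative (\<lambda>s. s *\<^sub>R D (z$2))) (at (z$2))"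
      using c[of "z$2"] that unfolding B has_vector_derivative_def by auto
    from has_derivative_scaleR[OF 1[of 1] has_derivative_compose[OF 1[of 2] this]]
    show ?thesis .
  qed
  have det: "det (matrix (?\<Phi>' z)) = z$1 * J (z$2)" for z
    by (simp add: det_2 matrix_def J_def axis_def algebra_simps)
  have c_cont: "continuous_on {0..1} c"
    using c by (intro continuous_at_imp_continuous_on ballI has_vector_derivative_continuous)
  have J_cont: "continuous_on {0..1} J"
    unfolding J_def by (intro continuous_intros c_cont D)
  have q_cont: "continuous_on {0..1} (\<lambda>u. w (c u) * \<bar>J u\<bar>)"
    by (intro continuous_intros w J_cont)
  let ?k = "\<lambda>z::real^2. z$1 * (w (c (z$2)) * \<bar>J (z$2)\<bar>)"
  have k_cont: "continuous_on ?B ?k"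
    by (intro continuous_intros continuous_on_compose2[OF q_cont]) (auto simp: B)
  have "integral {0..1} (\<lambda>t::real. t) = 1 / 2"
    using ident_has_integral[of 0 "1::real"] by (simp add: integral_unique)
  then have k_int: "integral ?B ?k = integral {0..1} (\<lambda>u. w (c u) * \<bar>J u\<bar>) / 2"
    using integral_unit_square_product[OF continuous_on_id q_cont]
    by (simp add: integral_unique)
  have k_abs: "?k absolutely_integrable_on ?B"
    by (rule absolutely_integrable_continuous[OF k_cont])
  have zero: "?k z = 0" if "z \<in> ?B - ?S" for z
    using that by auto
  have spike: "?k absolutely_integrable_on ?S" "integral ?S ?k = integral ?B ?k"
  proof -
    have e: "{z \<in> ?S - ?B. ?k z \<noteq> 0} = {}" "{z \<in> ?B - ?S. ?k z \<noteq> 0} = {}"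
      using zero by auto
    show "integral ?S ?k = integral ?B ?k"
      by (rule integral_spike_set) (simp_all only: e negligible_empty)
    show "?k absolutely_integrable_on ?S"
      using k_abs absolutely_integrable_spike_set_eq[of ?S ?B ?k] e by (simp only: negligible_empty simp_thms)
  qed
  have pull: "\<bar>det (matrix (?\<Phi>' z))\<bar> * w (?\<Phi> z) = ?k z" if "z \<in> ?S" for z
    unfolding det using that radial[of "z$1" "z$2"] by (auto simp: B abs_mult)
  have S_sets: "?S \<in> sets lebesgue"
  proof -
    have "continuous_on ?B (\<lambda>z. z$1 * J (z$2))"
      by (intro continuous_intros continuous_on_compose2[OF J_cont]) (auto simp: B)
    then have "openin (top_of_set ?B) (?B \<inter> (\<lambda>z. z$1 * J (z$2)) -` (- {0}))"
      by (rule continuous_openin_preimage_gen) auto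
    then obtain T where "open T" "?B \<inter> (\<lambda>z. z$1 * J (z$2)) -` (- {0}) = ?B \<inter> T"
      by (auto simp: openin_open)
    moreover have "?S = ?B \<inter> (\<lambda>z. z$1 * J (z$2)) -` (- {0})"
      by auto
    ultimately show ?thesis
      by (metis borel_closed borel_open closed_cbox sets.Int sets_completionI_sets sets_lborel)
  qed
  have inj_S: "inj_on ?\<Phi> ?S"
  proof (rule inj_onI)
    fix y z assume "y \<in> ?S" "z \<in> ?S" "?\<Phi> y = ?\<Phi> z"
    then have "(y$1, y$2) = (z$1, z$2)"
      by (intro inj_onD[OF inj]) (auto simp: B order_less_le)
    then show "y = z" by (simp add: vec_eq_iff forall_2)
  qed
  have neg: "negligible (?\<Phi> ` ?N)"
  proof (rule baby_Sard[OF order_refl])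
    show "(?\<Phi> has_derivative ?\<Phi>' z) (at z within ?N)" if "z \<in> ?N" for z
      using that by (intro der) auto
    show "rank (matrix (?\<Phi>' z)) < CARD(2)" if "z \<in> ?N" for z
      using that det[of z] by (simp add: det_eq_0_rank[symmetric] del: card_bit0)
  qed
  have sector: "sector c = ?\<Phi> ` ?S \<union> ?\<Phi> ` ?N"
  proof -
    have "sector c = ?\<Phi> ` ?B"
    proof (intro equalityI subsetI)
      fix p assume "p \<in> sector c"
      then obtain t u where "0 \<le> t" "t \<le> 1" "u \<in> {0..1}" "p = t *\<^sub>R c u"
        by (auto simp: sector_def path_image_def)
      then show "p \<in> ?\<Phi> ` ?B"
        by (intro image_eqI[of _ _ "vector [t, u]"]) (auto simp: B)
    next
      fix p assume "p \<in> ?\<Phi> ` ?B"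
      then obtain z where "z$1 \<in> {0..1}" "z$2 \<in> {0..1}" "p = ?\<Phi> z"
        by (auto simp: B)
      then show "p \<in> sector c"
        unfolding sector_def path_image_def mem_Collect_eq
        by (intro exI[of _ "z$1"] exI[of _ "c (z$2)"]) simp
    qed
    also have "?B = ?S \<union> ?N" by blast
    finally show ?thesis by (simp add: image_Un)
  qed
  \<comment> \<open>The change of variables formula is about vector-valued functions; real ones are lifted to
    \<open>real^1\<close>.\<close>
  let ?vw = "\<lambda>y. vec (w y) :: real^1"
  have "(\<lambda>z. \<bar>det (matrix (?\<Phi>' z))\<bar> *\<^sub>R ?vw (?\<Phi> z)) absolutely_integrable_on ?S \<and>
      integral ?S (\<lambda>z. \<bar>det (matrix (?\<Phi>' z))\<bar> *\<^sub>R ?vw (?\<Phi> z)) = vec (integral ?B ?k)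
    \<longleftrightarrow> ?vw absolutely_integrable_on ?\<Phi> ` ?S \<and> integral (?\<Phi> ` ?S) ?vw = vec (integral ?B ?k)"
    by (rule has_absolute_integral_change_of_variables[OF S_sets _ inj_S]) (rule der, blast)
  moreover have "(\<lambda>z. \<bar>det (matrix (?\<Phi>' z))\<bar> * w (?\<Phi> z)) absolutely_integrable_on ?S"
    by (rule iffD2[OF set_integrable_cong[OF refl refl pull] spike(1)])
  moreover have "integral ?S (\<lambda>z. \<bar>det (matrix (?\<Phi>' z))\<bar> * w (?\<Phi> z)) = integral ?B ?k"
    by (rule trans[OF integral_cong[OF pull] spike(2)])
  ultimately have img: "w absolutely_integrable_on ?\<Phi> ` ?S" "integral (?\<Phi> ` ?S) w = integral ?B ?k"
    by (auto simp: absolutely_integrable_on_1_iff integral_on_1_eq)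
  have n: "negligible {y \<in> ?\<Phi> ` ?S - sector c. w y \<noteq> 0}" "negligible {y \<in> sector c - ?\<Phi> ` ?S. w y \<noteq> 0}"
    by (rule negligible_subset[OF neg]; use sector in blast)+
  show "w absolutely_integrable_on sector c"
    using img(1) absolutely_integrable_spike_set_eq[OF n] by blast
  show "integral (sector c) w = integral {0..1} (\<lambda>u. w (c u) * \<bar>J u\<bar>) / 2"
    using integral_spike_set[OF n] img(2) k_int by simp
qed

section \<open>Arc length and area on the indicatrix\<close>

lemma mono_on_has_real_derivative_nonneg:
  fixes f :: "real \<Rightarrow> real"
  assumes "mono_on S f" "(f has_real_derivative d) (at x within S)" "x \<in> S" "at x within S \<noteq> bot"
  shows "0 \<le> d"
proof (rule tendsto_lowerbound)
  show "((\<lambda>y. (f y - f x) / (y - x)) \<longlongrightarrow> d) (at x within S)"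
    using assms(2) by (simp add: has_field_derivative_iff)
  have "0 \<le> (f y - f x) / (y - x)" if "y \<in> S" for y
    using assms(3) that mono_onD[OF assms(1), of x y] mono_onD[OF assms(1), of y x]
    by (cases "x \<le> y") (auto intro: divide_nonneg_nonneg divide_nonpos_nonpos)
  then show "\<forall>\<^sub>F y in at x within S. 0 \<le> (f y - f x) / (y - x)"
    by (simp add: eventually_at_filter)
qed fact

text \<open>
  The statement \<open>ds = d\<theta>\<close>. As \<open>F\<close> is constant along the arc, \<open>c'\<close> is tangent to the indicatrix, so
  the speed is \<open>\<surd>g \<bar>det(c, c')\<bar>\<close> by the Gram determinant, while \<open>d\<theta>/du = \<surd>g det(c, c')\<close> by the
  definition of the angle. Monotonicity of \<open>\<theta>\<close> along the arc makes the latter nonnegative, and the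
  two agree.
\<close>

lemma arc_angle_derivative:
  assumes F: "finsler_metric U F" and \<theta>: "angle_function U F C \<theta>" and x: "x \<in> U"
    and arc: "indicatrix_arc F C \<theta> x y1 y2 c" and u: "u \<in> {0..1}"
  defines "D \<equiv> vector_derivative c (at u)"
  shows "((\<lambda>v. \<theta> x (c v)) has_real_derivative finsler_speed F x c u) (at u within {0..1})"
    and "finsler_speed F x c u
      = sqrt (det (metric_tensor F x (c u))) * \<bar>c u $ 1 * D $ 2 - c u $ 2 * D $ 1\<bar>"
proof -
  let ?J = "c u $ 1 * D $ 2 - c u $ 2 * D $ 1" and ?g = "det (metric_tensor F x (c u))"
  have Fc: "F x (c v) = 1" and Cc: "(x, c v) \<in> C" if "v \<in> {0..1}" for v
    using arc that by (auto simp: indicatrix_arc_def)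
  have nz: "c u \<noteq> 0"
    using Cc[OF u] \<theta> by (auto simp: angle_function_def)
  have c: "(c has_derivative (\<lambda>s. s *\<^sub>R D)) (at u within {0..1})"
    using arc u unfolding indicatrix_arc_def C1_differentiable_on_eq D_def
    by (auto simp: vector_derivative_works has_vector_derivative_def intro: has_derivative_at_withinI)
  have nontriv: "at u within {0..1} \<noteq> bot"
    using u by (auto simp: trivial_limit_within intro!: islimpt_closure_open[where s = "{0<..<1}"])
  have "((\<lambda>v. F x (c v)) has_vector_derivative (\<Sum>k\<in>UNIV. partial k (F x) (c u) * D $ k)) (at u within {0..1})"
    using has_derivative_compose[OF c has_derivative_partial[OF finsler_differentiable[OF F x nz]]]
    by (simp add: has_vector_derivative_def sum_distrib_left mult_ac)
  moreover have "((\<lambda>v. F x (c v)) has_vector_derivative 0) (at u within {0..1})"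
    by (rule has_vector_derivative_transform[OF u _ has_vector_derivative_const[of 1]]) (simp add: Fc)
  ultimately have "(\<Sum>k\<in>UNIV. partial k (F x) (c u) * D $ k) = 0"
    by (rule vector_derivative_unique_within[OF nontriv])
  then have "(\<Sum>k\<in>UNIV. covec F x (c u) $ k * D $ k) = 0"
    using Fc[OF u] by (simp add: covec_def)
  from indicatrix_tangent_form[OF F x Fc[OF u] nz this]
  have speed: "finsler_speed F x c u = sqrt ?g * \<bar>?J\<bar>"
    by (simp add: finsler_speed_def D_def real_sqrt_mult)
  have deriv: "((\<lambda>v. \<theta> x (c v)) has_real_derivative sqrt ?g * ?J) (at u within {0..1})"
  proof -
    have "((\<lambda>v. \<theta> x (c v)) has_derivative
        (\<lambda>s. sqrt ?g * (c u $ 1 * (s *\<^sub>R D) $ 2 - c u $ 2 * (s *\<^sub>R D) $ 1))) (at u within {0..1})"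
      by (rule has_derivative_compose[OF c angle_has_derivative[OF \<theta> Cc[OF u] Fc[OF u]]])
    moreover have "(\<lambda>s. sqrt ?g * (c u $ 1 * (s *\<^sub>R D) $ 2 - c u $ 2 * (s *\<^sub>R D) $ 1)) = (*) (sqrt ?g * ?J)"
      by (simp add: fun_eq_iff algebra_simps)
    ultimately show ?thesis
      by (simp add: has_field_derivative_def)
  qed
  have "mono_on {0..1} (\<lambda>v. \<theta> x (c v))"
    using arc by (simp add: indicatrix_arc_def)
  from mono_on_has_real_derivative_nonneg[OF this deriv u nontriv]
  have "finsler_speed F x c u = sqrt ?g * ?J"
    using det_metric_tensor_pos[OF F x nz] by (auto simp: speed zero_le_mult_iff)
  then show "((\<lambda>v. \<theta> x (c v)) has_real_derivative finsler_speed F x c u) (at u within {0..1})"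
    using deriv by simp
  show "finsler_speed F x c u = sqrt ?g * \<bar>?J\<bar>"
    by (rule speed)
qed

text \<open>
  If the arc returned to a point, then \<open>\<theta>\<close>, being a function of the point and monotone along the
  arc, would be constant in between, and its derivative, the speed, would vanish. In particular
  the arc cannot wind once around the origin.
\<close>

lemma arc_injective_where_moving:
  assumes F: "finsler_metric U F" and \<theta>: "angle_function U F C \<theta>" and x: "x \<in> U"
    and arc: "indicatrix_arc F C \<theta> x y1 y2 c"
    and u: "u \<in> {0..1}" "v \<in> {0..1}" "c u = c v" and speed: "finsler_speed F x c u \<noteq> 0"
  shows "u = v"
proof (rule ccontr)
  assume "u \<noteq> v"
  define a b where "a = min u v" and "b = max u v"
  have ab: "a < b" "u \<in> {a..b}" "{a..b} \<subseteq> {0..1}" "c a = c b"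
    using u \<open>u \<noteq> v\<close> by (auto simp: a_def b_def min_def max_def)
  have mono: "mono_on {0..1} (\<lambda>v. \<theta> x (c v))"
    using arc by (simp add: indicatrix_arc_def)
  have const: "\<theta> x (c a) = \<theta> x (c w)" if "w \<in> {a..b}" for w
    using mono_onD[OF mono, of a w] mono_onD[OF mono, of w b] that ab by fastforce
  have "((\<lambda>v. \<theta> x (c v)) has_vector_derivative finsler_speed F x c u) (at u within cbox a b)"
    using arc_angle_derivative(1)[OF F \<theta> x arc u(1)] ab(3)
    by (auto simp: has_real_derivative_iff_has_vector_derivative intro: has_vector_derivative_within_subset)
  moreover have "((\<lambda>v. \<theta> x (c v)) has_vector_derivative 0) (at u within cbox a b)"
    by (rule has_vector_derivative_transform[OF _ _ has_vector_derivative_const[of "\<theta> x (c a)"]])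
      (use const ab in auto)
  ultimately have "finsler_speed F x c u = 0"
    using vector_derivative_unique_within_closed_interval[OF \<open>a < b\<close>] ab(2) by auto
  with speed show False by simp
qed

theorem mainTheorem4:
  fixes U :: "(real^2) set" and F :: "real^2 \<Rightarrow> real^2 \<Rightarrow> real"
    and C :: "((real^2) \<times> (real^2)) set" and \<theta> :: "real^2 \<Rightarrow> real^2 \<Rightarrow> real"
    and x y1 y2 :: "real^2" and c :: "real \<Rightarrow> real^2"
  assumes "finsler_metric U F"
    and "angle_function U F C \<theta>"
    and "x \<in> U"
    and "y1 \<noteq> 0" and "y2 \<noteq> 0"
    and "indicatrix_arc F C \<theta> x y1 y2 c"
  shows "(\<forall>u\<in>{0..1}. ((\<lambda>v. \<theta> x (c v)) has_real_derivative finsler_speed F x c u)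
            (at u within {0..1})) \<and>
    (\<forall>u v. 0 \<le> u \<and> u \<le> v \<and> v \<le> 1 \<longrightarrow>
       (finsler_speed F x c has_integral (\<theta> x (c v) - \<theta> x (c u))) {u..v}) \<and>
    (\<lambda>y. sqrt (det (metric_tensor F x y))) absolutely_integrable_on sector c \<and>
    sector_area F x (sector c) = (\<theta> x y2 - \<theta> x y1) / 2"
proof -
  note F = assms(1) and \<theta> = assms(2) and x = assms(3) and arc = assms(6)
  let ?w = "\<lambda>y. sqrt (det (metric_tensor F x y))" and ?s = "finsler_speed F x c"
  let ?D = "\<lambda>u. vector_derivative c (at u)"
  let ?J = "\<lambda>u. c u $ 1 * ?D u $ 2 - c u $ 2 * ?D u $ 1"
  have deriv: "((\<lambda>v. \<theta> x (c v)) has_real_derivative ?s u) (at u within {0..1})"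
    and speed: "?s u = ?w (c u) * \<bar>?J u\<bar>" if "u \<in> {0..1}" for u
    using arc_angle_derivative[OF F \<theta> x arc that] by auto
  have integral: "(?s has_integral (\<theta> x (c v) - \<theta> x (c u))) {u..v}" if "0 \<le> u" "u \<le> v" "v \<le> 1" for u v
  proof (rule fundamental_theorem_of_calculus[OF \<open>u \<le> v\<close>])
    show "((\<lambda>v. \<theta> x (c v)) has_vector_derivative ?s t) (at t within {u..v})" if "t \<in> {u..v}" for t
      using deriv[of t] that \<open>0 \<le> u\<close> \<open>v \<le> 1\<close>
      unfolding has_real_derivative_iff_has_vector_derivative
      by (auto intro: has_vector_derivative_within_subset)
  qed
  have C1: "\<And>u. u \<in> {0..1} \<Longrightarrow> (c has_vector_derivative ?D u) (at u)" "continuous_on {0..1} ?D"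
    using arc by (auto simp: indicatrix_arc_def C1_differentiable_on_eq vector_derivative_works)
  have Fc: "F x (c u) = 1" and nz: "c u \<noteq> 0" if "u \<in> {0..1}" for u
    using arc \<theta> that by (auto simp: indicatrix_arc_def angle_function_def)
  have wpos: "?w (c u) > 0" if "u \<in> {0..1}" for u
    using det_metric_tensor_pos[OF F x nz[OF that]] by simp
  have "continuous_on (- {0}) ?w"
    unfolding det_2 by (intro continuous_intros continuous_metric_tensor[OF F x])
  then have w_cont: "continuous_on {0..1} (\<lambda>u. ?w (c u))"
  proof (rule continuous_on_compose2)
    show "continuous_on {0..1} c"
      using C1(1) by (intro continuous_at_imp_continuous_on ballI has_vector_derivative_continuous)
    show "c ` {0..1} \<subseteq> - {0}"
      using nz by auto
  qed
  have radial: "?w (t *\<^sub>R c u) = ?w (c u)" if "0 < t" "u \<in> {0..1}" for t u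
    using metric_tensor_homogeneous[OF F x nz[OF that(2)] that(1)] by simp
  \<comment> \<open>\<open>F\<close> recovers \<open>t\<close> from \<open>t c(u)\<close>, as \<open>F = 1\<close> on the arc; then \<open>u\<close> is determined because the arc moves.\<close>
  have inj: "inj_on (\<lambda>(t, u). t *\<^sub>R c u) ({0<..1} \<times> {u \<in> {0..1}. ?J u \<noteq> 0})"
  proof (rule inj_onI)
    fix p q
    assume "p \<in> {0<..1} \<times> {u \<in> {0..1}. ?J u \<noteq> 0}" "q \<in> {0<..1} \<times> {u \<in> {0..1}. ?J u \<noteq> 0}"
      and "(\<lambda>(t, u). t *\<^sub>R c u) p = (\<lambda>(t, u). t *\<^sub>R c u) q"
    then obtain t u t' u' where pq: "p = (t, u)" "q = (t', u')" and t: "0 < t" "0 < t'"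
      and u: "u \<in> {0..1}" "u' \<in> {0..1}" and J: "?J u \<noteq> 0" and eq: "t *\<^sub>R c u = t' *\<^sub>R c u'"
      by auto
    have "F x (s *\<^sub>R c v) = s" if "0 < s" "v \<in> {0..1}" for s v
      using F x Fc nz that by (simp add: finsler_metric_def)
    then have "t = t'"
      using t u eq by metis
    moreover from this have "c u = c u'"
      using eq t by simp
    then have "u = u'"
      using u J speed[of u] wpos[of u] by (intro arc_injective_where_moving[OF F \<theta> x arc]) auto
    ultimately show "p = q"
      by (simp add: pq)
  qed
  note area = sector_integral[OF C1 w_cont radial inj]
  have "integral {0..1} (\<lambda>u. ?w (c u) * \<bar>?J u\<bar>) = integral {0..1} ?s"
    by (rule integral_cong) (rule speed[symmetric])
  also have "\<dots> = \<theta> x (c 1) - \<theta> x (c 0)"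
    using integral[of 0 1] by (simp add: integral_unique)
  also have "\<dots> = \<theta> x y2 - \<theta> x y1"
  proof -
    have "\<theta> x (c u) = \<theta> x y" if "u \<in> {0..1}" "y \<noteq> 0" "c u = unit_vec F x y" for u y
    proof -
      have pos: "F x y > 0"
        using F x that(2) by (simp add: finsler_metric_def)
      then have "y = F x y *\<^sub>R c u"
        using that(3) by (simp add: unit_vec_def vec_eq_iff)
      moreover have "\<theta> x (F x y *\<^sub>R c u) = \<theta> x (c u)"
        using \<theta> arc pos that(1) unfolding angle_function_def indicatrix_arc_def by blast
      ultimately show ?thesis by simp
    qed
    from this[of 0 y1] this[of 1 y2] show ?thesis
      using arc assms(4,5) by (simp add: indicatrix_arc_def pathstart_def pathfinish_def)
  qed
  finally have "sector_area F x (sector c) = (\<theta> x y2 - \<theta> x y1) / 2"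
    using area(2) by (simp add: sector_area_def)
  with deriv integral area(1) show ?thesis by blast
qed

end
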